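(* If an SCC $F:\Theta\to 2^Z\setminus\{\emptyset\}$ is rationalizably implementable, then $F$ is mixed-Nash-A-implementable.
   Context: Standing setup: $\mathcal I=\{1,\dots,I\}$ finite, $I\ge 3$; $\Theta$ finite or countably infinite; $Z$ finite; $Y=\Delta(Z)$; $u_i^\theta:Z\to\mathbb R$ extended to lotteries by expected utility $U_i^\theta$. A mechanism $\mathcal M=\langle M=\times_iM_i,g:M\to Y\rangle$ has countable $M_i$; $g(\lambda)$ is the induced lottery of a profile; $MNE^{(\mathcal M,\theta)}$ is the set of mixed Nash equilibria at $\theta$. $F$ is mixed-Nash-A-implementable if some $\mathcal M$ has $\bigcup_{\lambda\in MNE^{(\mathcal M,\theta)}}\mathrm{SUPP}(g[\lambda])=F(\theta)$ for all $\theta$. Rationalizability: let $\mathcal S=\times_i2^{M_i}$, ordered by componentwise inclusion; for $S\in\mathcal S$, $b_i^{\mathcal M,\theta}(S)$ is the set of $m_i\in M_i$ for which there exists $\lambda_{-i}\in\Delta(M_{-i})$ with $\lambda_{-i}(m_{-i})>0\Rightarrow m_{-i}\in S_{-i}$ and $m_i\in\arg\max_{m_i'\in M_i}\sum_{m_{-i}}\lambda_{-i}(m_{-i})U_i^\theta(g(m_i',m_{-i}))$. The operator $b^{\mathcal M,\theta}=(b_i^{\mathcal M,\theta})_i$ is monotone; $S^{\mathcal M,\theta}=(S_i^{\mathcal M,\theta})_i$ denotes its largest fixed point. $F$ is rationalizably implementable if some $\mathcal M$ satisfies $\bigcup_{m\in S^{\mathcal M,\theta}}\mathrm{SUPP}[g(m)]=F(\theta)$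 for all $\theta\in\Theta$ (here $m\in S^{\mathcal M,\theta}$ means $m_i\in S_i^{\mathcal M,\theta}$ for all $i$). *)

theory Defs
  imports "HOL-Probability.Probability"
begin

text \<open>Agents: a finite type 'i (all of UNIV); states: a countable type 'th;
 outcomes: a finite type 'z; lotteries Y = Delta(Z) are 'z pmf.
 Message spaces: countable sets, encoded as subsets of nat.
 A mechanism is given by M :: 'i => nat set and g :: ('i => nat) => 'z pmf;
 a message profile m lies in M iff m i : M i for all i (g matters only there).\<close>

definition EU :: "('i \<Rightarrow> 'th \<Rightarrow> 'z::finite \<Rightarrow> real) \<Rightarrow> 'i \<Rightarrow> 'th \<Rightarrow> 'z pmf \<Rightarrow> real" where
  "EU u i \<theta> y = (\<Sum>z\<in>UNIV. pmf y z * u i \<theta> z)"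

definition profiles :: "('i \<Rightarrow> nat set) \<Rightarrow> ('i \<Rightarrow> nat) set" where
  "profiles M = {m. \<forall>i. m i \<in> M i}"

definition mixed_profiles :: "('i \<Rightarrow> nat set) \<Rightarrow> ('i \<Rightarrow> nat pmf) set" where
  "mixed_profiles M = {lam. \<forall>i. set_pmf (lam i) \<subseteq> M i}"

definition induced_lottery :: "(('i::finite \<Rightarrow> nat) \<Rightarrow> 'z pmf) \<Rightarrow> ('i \<Rightarrow> nat pmf) \<Rightarrow> 'z pmf" where
  "induced_lottery g lam = bind_pmf (Pi_pmf UNIV 0 lam) g"

definition MNE :: "('i::finite \<Rightarrow> 'th \<Rightarrow> 'z::finite \<Rightarrow> real) \<Rightarrow> ('i \<Rightarrow> nat set)
    \<Rightarrow> (('i \<Rightarrow> nat) \<Rightarrow> 'z pmf) \<Rightarrow> 'th \<Rightarrow> ('i \<Rightarrow> nat pmf) set" where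
  "MNE u M g \<theta> = {lam \<in> mixed_profiles M.
      \<forall>i. \<forall>\<mu>. set_pmf \<mu> \<subseteq> M i \<longrightarrow>
        EU u i \<theta> (induced_lottery g (lam(i := \<mu>))) \<le> EU u i \<theta> (induced_lottery g lam)}"

definition mixed_nash_A_implementable :: "('i::finite \<Rightarrow> 'th \<Rightarrow> 'z::finite \<Rightarrow> real) \<Rightarrow> ('th \<Rightarrow> 'z set) \<Rightarrow> bool" where
  "mixed_nash_A_implementable u F \<longleftrightarrow>
     (\<exists>(M :: 'i \<Rightarrow> nat set) (g :: ('i \<Rightarrow> nat) \<Rightarrow> 'z pmf).
        \<forall>\<theta>. (\<Union>lam\<in>MNE u M g \<theta>. set_pmf (induced_lottery g lam)) = F \<theta>)"

text \<open>Best-reply operator b^{M,theta}. A belief lambda_{-i} in Delta(M_{-i}) is represented by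
 a pmf on full profiles whose i-th coordinate is ignored.\<close>
definition best_reply :: "('i \<Rightarrow> 'th \<Rightarrow> 'z::finite \<Rightarrow> real) \<Rightarrow> ('i \<Rightarrow> nat set)
    \<Rightarrow> (('i \<Rightarrow> nat) \<Rightarrow> 'z pmf) \<Rightarrow> 'th \<Rightarrow> ('i \<Rightarrow> nat set) \<Rightarrow> ('i \<Rightarrow> nat set)" where
  "best_reply u M g \<theta> S = (\<lambda>i. {mi \<in> M i. \<exists>bel :: ('i \<Rightarrow> nat) pmf.
      (\<forall>m\<in>set_pmf bel. \<forall>j. j \<noteq> i \<longrightarrow> m j \<in> M j \<and> m j \<in> S j) \<and>
      (\<forall>mi'\<in>M i. measure_pmf.expectation bel (\<lambda>m. EU u i \<theta> (g (m(i := mi'))))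
                 \<le> measure_pmf.expectation bel (\<lambda>m. EU u i \<theta> (g (m(i := mi)))))})"

definition rat_set :: "('i \<Rightarrow> 'th \<Rightarrow> 'z::finite \<Rightarrow> real) \<Rightarrow> ('i \<Rightarrow> nat set)
    \<Rightarrow> (('i \<Rightarrow> nat) \<Rightarrow> 'z pmf) \<Rightarrow> 'th \<Rightarrow> ('i \<Rightarrow> nat set)" where
  "rat_set u M g \<theta> = gfp (best_reply u M g \<theta>)"

definition rationalizably_implementable :: "('i::finite \<Rightarrow> 'th \<Rightarrow> 'z::finite \<Rightarrow> real) \<Rightarrow> ('th \<Rightarrow> 'z set) \<Rightarrow> bool" where
  "rationalizably_implementable u F \<longleftrightarrow>
     (\<exists>(M :: 'i \<Rightarrow> nat set) (g :: ('i \<Rightarrow> nat) \<Rightarrow> 'z pmf).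
        \<forall>\<theta>. (\<Union>m\<in>profiles (rat_set u M g \<theta>). set_pmf (g m)) = F \<theta>)"

end

theory Submission
  imports Defs
begin

text \<open>
  Fix a mechanism that rationalizably implements \<open>F\<close>, with rationalizable sets \<open>S\<^sup>\<theta>\<close>, and for
  every \<open>m \<in> S\<^sub>i\<^sup>\<theta>\<close> a belief on \<open>S\<^sub>-\<^sub>i\<^sup>\<theta>\<close> to which \<open>m\<close> is a best reply. In the new mechanism the agents
  announce a state. If all announce \<open>\<theta>\<close>, the outcome is a lottery with support \<open>F \<theta>\<close>: a mixture of
  all profiles of \<open>S\<^sup>\<theta>\<close> and of all pairs of a message \<open>m \<in> S\<^sub>i\<^sup>\<theta>\<close> and its belief. A single
  dissenter \<open>i\<close> may only replace \<open>m\<close> by some \<open>m'\<close> in one component of the latter kind, with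
  probability \<open>k / (k + 1)\<close>, where he chooses \<open>k\<close>. At \<open>\<theta>\<close> this never pays. If there are two or
  more dissenters, whoever shouts the largest integer dictates a profile of the old mechanism.

  In a mixed equilibrium at \<open>\<theta>'\<close>, agents who can start the integer game must already be at their
  maximum over the old mechanism, and since no \<open>k\<close> is maximal a replacement is at best neutral.
  Hence all \<open>m \<in> S\<^sub>i\<^sup>\<theta>\<close> are best replies at \<open>\<theta>'\<close>, either to the belief that rationalizes them at
  \<open>\<theta>\<close> or because everything they lead to is maximal. So \<open>S\<^sup>\<theta>\<close>, enlarged by the neutral
  replacement, is contained in \<open>S\<close> at \<open>\<theta>'\<close>, and the outcome stays in \<open>F \<theta>'\<close>.
\<close>

section \<open>Expectations of bounded functions under a pmf\<close>

lemma integrable_pmf_bounded: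
  fixes f :: "'a \<Rightarrow> real"
  assumes "\<And>x. \<bar>f x\<bar> \<le> K"
  shows "integrable (measure_pmf p) f"
  using assms by (intro measure_pmf.integrable_const_bound[where B = K]) auto

lemma abs_expectation_le:
  fixes f :: "'a \<Rightarrow> real"
  assumes "\<And>x. \<bar>f x\<bar> \<le> K"
  shows "\<bar>measure_pmf.expectation p f\<bar> \<le> K"
proof -
  have "\<bar>measure_pmf.expectation p f\<bar> \<le> measure_pmf.expectation p (\<lambda>x. \<bar>f x\<bar>)"
    by (rule integral_abs_bound)
  also have "\<dots> \<le> measure_pmf.expectation p (\<lambda>_. K)"
    using assms by (intro integral_mono) (auto intro: integrable_pmf_bounded[where K = K])
  finally show ?thesis by simp
qed

text \<open>For nonnegative functions \<open>nn_integral_bind_pmf\<close> gives the formula, so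
  \<open>f\<close> is shifted by \<open>K\<close> and the shift subtracted again.\<close>

lemma expectation_bind_pmf:
  fixes f :: "'b \<Rightarrow> real"
  assumes "\<And>x. \<bar>f x\<bar> \<le> K"
  shows "measure_pmf.expectation (bind_pmf p h) f
    = measure_pmf.expectation p (\<lambda>x. measure_pmf.expectation (h x) f)"
proof -
  note int = integrable_pmf_bounded[of f, OF assms]
  have E: "ennreal (measure_pmf.expectation q (\<lambda>x. f x + K)) = (\<integral>\<^sup>+x. ennreal (f x + K) \<partial>q)" for q
    using assms int by (intro nn_integral_eq_integral[symmetric] AE_I2) (auto simp: abs_le_iff add_nonneg_eq_0_iff, smt (verit))
  have nn: "0 \<le> measure_pmf.expectation q (\<lambda>x. f x + K)" for q
    using assms by (intro integral_nonneg_AE AE_I2) (smt (verit))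
  have add: "measure_pmf.expectation q (\<lambda>x. f x + K) = measure_pmf.expectation q f + K" for q
    using int by simp
  have "\<bar>f x + K\<bar> \<le> 2 * \<bar>K\<bar>" for x
    using assms[of x] by linarith
  then have int': "integrable (measure_pmf p) (\<lambda>x. measure_pmf.expectation (h x) (\<lambda>x. f x + K))"
    by (intro integrable_pmf_bounded abs_expectation_le)
  have "ennreal (measure_pmf.expectation (bind_pmf p h) (\<lambda>x. f x + K))
    = (\<integral>\<^sup>+x. ennreal (measure_pmf.expectation (h x) (\<lambda>x. f x + K)) \<partial>p)"
    by (simp only: E nn_integral_bind_pmf)
  also have "\<dots> = ennreal (measure_pmf.expectation p (\<lambda>x. measure_pmf.expectation (h x) (\<lambda>x. f x + K)))"
    by (rule nn_integral_eq_integral[OF int']) (use nn in auto)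
  finally have "measure_pmf.expectation (bind_pmf p h) (\<lambda>x. f x + K)
    = measure_pmf.expectation p (\<lambda>x. measure_pmf.expectation (h x) (\<lambda>x. f x + K))"
    using nn by (subst (asm) ennreal_inj) (auto intro!: integral_nonneg_AE)
  moreover have "integrable (measure_pmf p) (\<lambda>x. measure_pmf.expectation (h x) f)"
    by (rule integrable_pmf_bounded[OF abs_expectation_le[OF assms]])
  ultimately show ?thesis by (simp add: add)
qed

lemma expectation_mono_pmf:
  fixes f h :: "'a \<Rightarrow> real"
  assumes "\<And>x. \<bar>f x\<bar> \<le> K" "\<And>x. \<bar>h x\<bar> \<le> K" "\<And>x. x \<in> set_pmf p \<Longrightarrow> f x \<le> h x"
  shows "measure_pmf.expectation p f \<le> measure_pmf.expectation p h"
  using assms by (intro integral_mono_AE integrable_pmf_bounded[where K = K] AE_pmfI) auto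

text \<open>\<open>h - f\<close> is nonnegative on the support and has integral 0. This turns
  equilibrium conditions on averages into conditions at every profile that is played.\<close>

lemma expectation_eqD:
  fixes f h :: "'a \<Rightarrow> real"
  assumes bf: "\<And>x. \<bar>f x\<bar> \<le> K" and bh: "\<And>x. \<bar>h x\<bar> \<le> L"
    and le: "\<And>x. x \<in> set_pmf p \<Longrightarrow> f x \<le> h x"
    and int: "measure_pmf.expectation p h \<le> measure_pmf.expectation p f"
    and x: "x \<in> set_pmf p"
  shows "f x = h x"
proof -
  note i = integrable_pmf_bounded[of f, OF bf] integrable_pmf_bounded[of h, OF bh]
  have nn: "AE x in measure_pmf p. 0 \<le> h x - f x"
    using le by (intro AE_pmfI) auto
  have "measure_pmf.expectation p (\<lambda>x. h x - f x) = 0"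
    using integral_nonneg_AE[OF nn] int i by simp
  then have "AE x in measure_pmf p. h x - f x = 0"
    using i integral_nonneg_eq_0_iff_AE[OF _ nn] by simp
  then show ?thesis using x by (auto simp: AE_measure_pmf_iff)
qed

lemma exists_pmf_with_support:
  assumes "countable A" "A \<noteq> {}"
  obtains p where "set_pmf p = A"
proof
  show "set_pmf (map_pmf (from_nat_into A) (geometric_pmf (1/2))) = A"
    using assms by (simp add: set_pmf_geometric range_from_nat_into)
qed

section \<open>Expected utilities of compound lotteries\<close>

lemma EU_expectation: "EU u i \<theta> y = measure_pmf.expectation y (u i \<theta>)"
  unfolding EU_def by (subst integral_measure_pmf_real[where A = UNIV]) (auto simp: mult.commute)

definition util_bound :: "('i \<Rightarrow> 'th \<Rightarrow> 'z::finite \<Rightarrow> real) \<Rightarrow> 'i \<Rightarrow> 'th \<Rightarrow> real" where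
  "util_bound u i \<theta> = (\<Sum>z\<in>UNIV. \<bar>u i \<theta> z\<bar>)"

lemma util_le_bound: "\<bar>u i \<theta> z\<bar> \<le> util_bound u i \<theta>"
  unfolding util_bound_def by (rule member_le_sum) auto

lemma EU_le_bound: "\<bar>EU u i \<theta> y\<bar> \<le> util_bound u i \<theta>"
  unfolding EU_expectation by (rule abs_expectation_le[OF util_le_bound])

lemma EU_bind: "EU u i \<theta> (bind_pmf p g) = measure_pmf.expectation p (\<lambda>m. EU u i \<theta> (g m))"
  unfolding EU_expectation by (rule expectation_bind_pmf[OF util_le_bound])

lemma Pi_pmf_fun_upd:
  fixes lam :: "'i::finite \<Rightarrow> 'a pmf"
  shows "Pi_pmf UNIV d (lam(i := \<mu>))
    = bind_pmf \<mu> (\<lambda>t. map_pmf (\<lambda>f. f(i := t)) (Pi_pmf (UNIV - {i}) d lam))"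
proof -
  have "Pi_pmf (insert i (UNIV - {i})) d (lam(i := \<mu>))
      = bind_pmf \<mu> (\<lambda>t. map_pmf (\<lambda>f. f(i := t)) (Pi_pmf (UNIV - {i}) d (lam(i := \<mu>))))"
    by (subst Pi_pmf_insert') (auto simp: map_pmf_def)
  moreover have "Pi_pmf (UNIV - {i}) d (lam(i := \<mu>)) = Pi_pmf (UNIV - {i}) d lam"
    by (rule Pi_pmf_cong) auto
  ultimately show ?thesis by (simp add: insert_absorb)
qed

section \<open>Best replies and rationalizable sets\<close>

lemma mono_best_reply: "mono (best_reply u M g \<theta>)"
  unfolding best_reply_def
  by (intro monoI le_funI subsetI) (clarsimp simp: le_fun_def, meson subsetD)

lemma rat_set_fixpoint: "best_reply u M g \<theta> (rat_set u M g \<theta>) = rat_set u M g \<theta>"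
  unfolding rat_set_def using gfp_unfold[OF mono_best_reply] by metis

lemma rat_set_coinduct: "S \<le> best_reply u M g \<theta> S \<Longrightarrow> S \<le> rat_set u M g \<theta>"
  unfolding rat_set_def by (rule gfp_upperbound)

lemma rat_set_subset: "rat_set u M g \<theta> i \<subseteq> M i"
  using rat_set_fixpoint[of u M g \<theta>] unfolding best_reply_def by (auto simp: fun_eq_iff)

lemma best_replyI:
  assumes "mi \<in> M i" "\<And>m j. m \<in> set_pmf b \<Longrightarrow> j \<noteq> i \<Longrightarrow> m j \<in> M j \<and> m j \<in> S j"
    and "\<And>mi'. mi' \<in> M i \<Longrightarrow> measure_pmf.expectation b (\<lambda>m. EU u i \<theta> (g (m(i := mi'))))
                 \<le> measure_pmf.expectation b (\<lambda>m. EU u i \<theta> (g (m(i := mi))))"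
  shows "mi \<in> best_reply u M g \<theta> S i"
  using assms unfolding best_reply_def by blast

text \<open>The point belief at \<open>m\<close> serves: changing one coordinate of \<open>m\<close>
  yields another profile of \<open>M\<close>, where \<open>m\<close> is maximal for
  \<open>i\<close>.\<close>

lemma best_replyI_pure:
  assumes m: "\<And>j. m j \<in> M j" "\<And>j. j \<noteq> i \<Longrightarrow> m j \<in> S j"
    and max: "\<And>a. a \<in> profiles M \<Longrightarrow> EU u i \<theta> (g a) \<le> EU u i \<theta> (g m)"
  shows "m i \<in> best_reply u M g \<theta> S i"
proof (rule best_replyI[where b = "return_pmf m"])
  show "measure_pmf.expectation (return_pmf m) (\<lambda>m. EU u i \<theta> (g (m(i := mi'))))
      \<le> measure_pmf.expectation (return_pmf m) (\<lambda>m'. EU u i \<theta> (g (m'(i := m i))))"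
    if "mi' \<in> M i" for mi'
    using max[of "m(i := mi')"] m that by (auto simp: profiles_def)
qed (use m in auto)

section \<open>Messages of the new mechanism\<close>

text \<open>
  \<open>Dev n W a\<close> bids \<open>n\<close> in the integer game with wish \<open>a\<close>. An entry \<open>(\<theta>, m, m', k)\<close> of the list \<open>W\<close>
  asks to replace \<open>m\<close> by \<open>m'\<close> if all others agree on \<open>\<theta>\<close>. In a mixed equilibrium a dissenter faces
  agreement on several states at once, so that requests for different states have to be independent.
\<close>
datatype ('t, 'p) msg = Agree 't | Dev nat "('t \<times> nat \<times> nat \<times> nat) list" 'p

instance msg :: (countable, countable) countable
  by countable_datatype

primrec rank :: "('t, 'p) msg \<Rightarrow> nat" where
  "rank (Agree _) = 0"
| "rank (Dev n _ _) = n"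

primrec whistle_list :: "('t, 'p) msg \<Rightarrow> ('t \<times> nat \<times> nat \<times> nat) list" where
  "whistle_list (Agree _) = []"
| "whistle_list (Dev _ W _) = W"

primrec wish :: "('t, 'p) msg \<Rightarrow> 'p" where
  "wish (Agree _) = undefined"
| "wish (Dev _ _ a) = a"

definition agree_but :: "'i \<Rightarrow> 't \<Rightarrow> ('i \<Rightarrow> ('t, 'p) msg) \<Rightarrow> bool" where
  "agree_but i \<theta> s \<longleftrightarrow> (\<forall>j. j \<noteq> i \<longrightarrow> s j = Agree \<theta>)"

lemma agree_but_upd [simp]: "agree_but i \<theta> (s(i := t)) = agree_but i \<theta> s"
  by (auto simp: agree_but_def)

definition top_rank :: "'i \<Rightarrow> ('i \<Rightarrow> ('t, 'p) msg) \<Rightarrow> bool" where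
  "top_rank i s \<longleftrightarrow> (\<forall>j. j \<noteq> i \<longrightarrow> rank (s j) < rank (s i))"

lemma top_rank_unique: "top_rank i s \<Longrightarrow> top_rank j s \<Longrightarrow> i = j"
  unfolding top_rank_def by (metis less_asym)

lemma third_agent:
  fixes i j :: "'i::finite"
  assumes "CARD('i) \<ge> 3"
  obtains k where "k \<noteq> i" "k \<noteq> j"
proof -
  have "card {i, j} < CARD('i)"
    using assms card_insert_le_m1[of 2 "{j}" i] by simp
  then have "{i, j} \<noteq> UNIV" by (metis less_irrefl)
  with that show ?thesis by blast
qed

text \<open>The factor is 0 at 0, so a request with \<open>k = 0\<close> changes nothing, and it
  increases strictly, so no request is the strongest.\<close>

definition tilt :: "nat \<Rightarrow> real" where
  "tilt k = k / (k + 1)"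

lemma tilt_0 [simp]: "tilt 0 = 0"
  by (simp add: tilt_def)

lemma tilt_nonneg [simp]: "0 \<le> tilt k"
  by (simp add: tilt_def)

lemma tilt_le_1 [simp]: "tilt k \<le> 1"
  by (simp add: tilt_def)

lemma tilt_pos: "k > 0 \<Longrightarrow> tilt k > 0"
  by (simp add: tilt_def)

lemma tilt_less_Suc: "tilt k < tilt (Suc k)"
  by (simp add: tilt_def field_simps)

text \<open>The choices behind the new mechanism. As supports are nonempty, the condition on
  \<open>tau\<close> also gives every state a rationalizable profile.\<close>

locale rationalizing_mechanism =
  fixes u :: "'i::finite \<Rightarrow> 'th::countable \<Rightarrow> 'z::finite \<Rightarrow> real"
    and M :: "'i \<Rightarrow> nat set" and g :: "('i \<Rightarrow> nat) \<Rightarrow> 'z pmf"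
    and d :: "'i \<Rightarrow> nat"
    and tau :: "'th \<Rightarrow> ('i \<Rightarrow> nat) pmf"
    and bel :: "'th \<Rightarrow> 'i \<Rightarrow> nat \<Rightarrow> ('i \<Rightarrow> nat) pmf"
  assumes card3: "CARD('i) \<ge> 3"
    and d: "d \<in> profiles M"
    and set_tau: "set_pmf (tau \<theta>) = profiles (rat_set u M g \<theta>)"
    and bel_rat: "\<lbrakk>m \<in> rat_set u M g \<theta> i; q \<in> set_pmf (bel \<theta> i m); j \<noteq> i\<rbrakk> \<Longrightarrow> q j \<in> rat_set u M g \<theta> j"
    and bel_opt: "\<lbrakk>m \<in> rat_set u M g \<theta> i; m' \<in> M i\<rbrakk> \<Longrightarrow>
      measure_pmf.expectation (bel \<theta> i m) (\<lambda>q. EU u i \<theta> (g (q(i := m'))))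
        \<le> measure_pmf.expectation (bel \<theta> i m) (\<lambda>q. EU u i \<theta> (g (q(i := m))))"
begin

abbreviation R where "R \<equiv> rat_set u M g"

definition V :: "'th \<Rightarrow> 'i \<Rightarrow> ('i \<Rightarrow> nat) \<Rightarrow> real" where
  "V \<theta> i m = EU u i \<theta> (g m)"

definition EV :: "'th \<Rightarrow> 'i \<Rightarrow> ('i \<Rightarrow> nat) pmf \<Rightarrow> real" where
  "EV \<theta> i p = measure_pmf.expectation p (V \<theta> i)"

lemma V_bound: "\<bar>V \<theta> i m\<bar> \<le> util_bound u i \<theta>"
  unfolding V_def by (rule EU_le_bound)

lemma EV_bound: "\<bar>EV \<theta> i p\<bar> \<le> util_bound u i \<theta>"
  unfolding EV_def by (rule abs_expectation_le[OF V_bound])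

lemma EV_bind: "EV \<theta> i (bind_pmf p f) = measure_pmf.expectation p (\<lambda>x. EV \<theta> i (f x))"
  unfolding EV_def by (rule expectation_bind_pmf[OF V_bound])

lemma EV_return [simp]: "EV \<theta> i (return_pmf m) = V \<theta> i m"
  unfolding EV_def by simp

text \<open>Requests and wishes may name any natural number; those outside \<open>M i\<close> are
  read as the default \<open>d i\<close>.\<close>

definition clamp :: "'i \<Rightarrow> nat \<Rightarrow> nat" where
  "clamp i m = (if m \<in> M i then m else d i)"

lemma clamp_in: "clamp i m \<in> M i"
  using d by (auto simp: clamp_def profiles_def)

lemma clamp_id: "m \<in> M i \<Longrightarrow> clamp i m = m"
  by (simp add: clamp_def)

definition clamp_profile :: "('i \<Rightarrow> nat) \<Rightarrow> ('i \<Rightarrow> nat)" where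
  "clamp_profile a = (\<lambda>j. clamp j (a j))"

lemma clamp_profile_in: "clamp_profile a \<in> profiles M"
  by (simp add: clamp_profile_def clamp_in profiles_def)

lemma clamp_profile_id: "a \<in> profiles M \<Longrightarrow> clamp_profile a = a"
  by (auto simp: clamp_profile_def clamp_def profiles_def)

section \<open>The lottery played on an agreed state\<close>

definition perturb :: "'i \<Rightarrow> (nat \<times> nat \<times> nat) option \<Rightarrow> 'i \<Rightarrow> nat \<Rightarrow> nat pmf" where
  "perturb i opt j m = (case opt of None \<Rightarrow> return_pmf m | Some (m0, m', k) \<Rightarrow>
     if j = i \<and> m = m0
     then map_pmf (\<lambda>b. if b then clamp i m' else m) (bernoulli_pmf (tilt k))
     else return_pmf m)"

text \<open>For \<open>x = None\<close> the profile \<open>p\<close> is played; for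
  \<open>x = Some j\<close> the message \<open>p j\<close> meets the belief that rationalizes it.
  The belief is drawn for \<open>p j\<close> even if a request has replaced that message, so a
  replacement is tested against the old belief.\<close>

definition component :: "'th \<Rightarrow> 'i \<Rightarrow> (nat \<times> nat \<times> nat) option \<Rightarrow> ('i \<Rightarrow> nat) \<times> 'i option
    \<Rightarrow> ('i \<Rightarrow> nat) pmf" where
  "component \<theta> i opt = (\<lambda>(p, x). case x of None \<Rightarrow> return_pmf p
     | Some j \<Rightarrow> bind_pmf (perturb i opt j (p j)) (\<lambda>r. map_pmf (\<lambda>q. q(j := r)) (bel \<theta> j (p j))))"

definition agreed :: "'th \<Rightarrow> 'i \<Rightarrow> (nat \<times> nat \<times> nat) option \<Rightarrow> ('i \<Rightarrow> nat) pmf" where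
  "agreed \<theta> i opt = bind_pmf (pair_pmf (tau \<theta>) (pmf_of_set UNIV)) (component \<theta> i opt)"

lemma agreed_None: "agreed \<theta> i None = agreed \<theta> j None"
  unfolding agreed_def component_def perturb_def by simp

text \<open>Agent \<open>i\<close>'s gain at \<open>\<theta>'\<close>, against the belief that rationalizes \<open>m\<close> at \<open>\<theta>\<close>.\<close>
definition gain :: "'th \<Rightarrow> 'th \<Rightarrow> 'i \<Rightarrow> nat \<Rightarrow> nat \<Rightarrow> real" where
  "gain \<theta>' \<theta> i m m' = EV \<theta>' i (map_pmf (\<lambda>q. q(i := m')) (bel \<theta> i m))
     - EV \<theta>' i (map_pmf (\<lambda>q. q(i := m)) (bel \<theta> i m))"

definition weight :: "'th \<Rightarrow> 'i \<Rightarrow> nat \<Rightarrow> real" where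
  "weight \<theta> i m = measure_pmf.prob (pair_pmf (tau \<theta>) (pmf_of_set UNIV)) {(p, x). x = Some i \<and> p i = m}"

lemma EV_map: "EV \<theta> i (map_pmf f p) = measure_pmf.expectation p (\<lambda>x. V \<theta> i (f x))"
  unfolding EV_def by simp

text \<open>The request matters only where \<open>x = Some i\<close> and \<open>p i = m\<close>;
  there \<open>m\<close> is replaced with probability \<open>tilt k\<close>. The payoff is thus
  affine in \<open>tilt k\<close>.\<close>

lemma EV_agreed_Some:
  "EV \<theta>' i (agreed \<theta> i (Some (m, m', k)))
    = EV \<theta>' i (agreed \<theta> i None) + weight \<theta> i m * tilt k * gain \<theta>' \<theta> i m (clamp i m')"
proof -
  let ?P = "pair_pmf (tau \<theta>) (pmf_of_set (UNIV :: 'i option set))"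
  let ?A = "{(p :: 'i \<Rightarrow> nat, x). x = Some i \<and> p i = m}"
  let ?c = "tilt k * gain \<theta>' \<theta> i m (clamp i m')"
  have pt: "EV \<theta>' i (component \<theta> i (Some (m, m', k)) px)
      = EV \<theta>' i (component \<theta> i None px) + ?c * indicator ?A px" for px
  proof (cases "px \<in> ?A")
    case True
    then obtain p where px: "px = (p, Some i)" "p i = m" by auto
    have "EV \<theta>' i (component \<theta> i (Some (m, m', k)) px)
      = tilt k * EV \<theta>' i (map_pmf (\<lambda>q. q(i := clamp i m')) (bel \<theta> i m))
        + (1 - tilt k) * EV \<theta>' i (map_pmf (\<lambda>q. q(i := m)) (bel \<theta> i m))"
      unfolding px component_def perturb_def
      by (simp add: bind_map_pmf EV_bind px(2))
    moreover have "EV \<theta>' i (component \<theta> i None px) = EV \<theta>' i (map_pmf (\<lambda>q. q(i := m)) (bel \<theta> i m))"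
      unfolding px component_def perturb_def by (simp add: bind_return_pmf px(2))
    ultimately show ?thesis using True
      by (simp add: gain_def algebra_simps)
  next
    case False
    then have "component \<theta> i (Some (m, m', k)) px = component \<theta> i None px"
      by (auto simp: component_def perturb_def split: option.splits prod.splits)
    with False show ?thesis by simp
  qed
  have "integrable (measure_pmf ?P) (\<lambda>px. EV \<theta>' i (component \<theta> i None px))"
    by (rule integrable_pmf_bounded[OF EV_bound])
  moreover have "integrable (measure_pmf ?P) (\<lambda>px. ?c * indicator ?A px)"
    by (rule integrable_pmf_bounded[where K = "\<bar>?c\<bar>"]) (auto split: split_indicator)
  ultimately show ?thesis
    unfolding agreed_def EV_bind pt weight_def by simp
qed

lemma weight_pos:
  assumes "m \<in> R \<theta> i"
  shows "weight \<theta> i m > 0"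
proof -
  obtain p where p: "p \<in> profiles (R \<theta>)"
    using set_pmf_not_empty[of "tau \<theta>"] by (auto simp: set_tau)
  have "(p(i := m), Some i) \<in> set_pmf (pair_pmf (tau \<theta>) (pmf_of_set UNIV))"
    using p assms by (auto simp: set_tau profiles_def set_pmf_of_set)
  then show ?thesis unfolding weight_def
    by (intro measure_pmf_posI) auto
qed

lemma weight_zero: "m \<notin> R \<theta> i \<Longrightarrow> weight \<theta> i m = 0"
  unfolding weight_def by (auto simp: measure_pmf_zero_iff set_tau profiles_def)

lemma rat_profiles_subset_agreed: "profiles (R \<theta>) \<subseteq> set_pmf (agreed \<theta> i opt)"
proof
  fix p assume "p \<in> profiles (R \<theta>)"
  then have "(p, None :: 'i option) \<in> set_pmf (pair_pmf (tau \<theta>) (pmf_of_set UNIV))"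
    by (simp add: set_tau set_pmf_of_set)
  then show "p \<in> set_pmf (agreed \<theta> i opt)"
    unfolding agreed_def set_bind_pmf by (rule UN_I) (simp add: component_def)
qed

lemma set_perturb:
  "r \<in> set_pmf (perturb i opt j m) \<Longrightarrow>
    r = m \<or> (\<exists>m' k. opt = Some (m, m', k) \<and> k > 0 \<and> j = i \<and> r = clamp i m')"
proof -
  assume r: "r \<in> set_pmf (perturb i opt j m)"
  \<comment> \<open>At \<open>k = 0\<close> the coin never shows \<open>True\<close>. This gives the
    \<open>k > 0\<close> on which \<open>MNE_gain\<close> relies.\<close>
  have "True \<notin> set_pmf (bernoulli_pmf 0)"
    by (simp add: set_pmf_iff)
  then have "opt = Some (m, m', 0) \<Longrightarrow> r = m" for m'
    using r by (auto simp: perturb_def split: if_splits)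
  with r show ?thesis
    by (auto simp: perturb_def split: option.splits if_splits intro!: gr0I)
qed

text \<open>\<open>tau\<close> and the beliefs about others stay within \<open>R \<theta>\<close>,
  so only the message that the dissenter substitutes can leave it.\<close>

lemma set_agreed:
  assumes "q \<in> set_pmf (agreed \<theta> i opt)"
  shows "q j \<in> R \<theta> j \<or> (\<exists>m m' k. opt = Some (m, m', k) \<and> k > 0 \<and> m \<in> R \<theta> i \<and> j = i \<and> q j = clamp i m')"
proof -
  obtain p x where p: "p \<in> profiles (R \<theta>)" and q: "q \<in> set_pmf (component \<theta> i opt (p, x))"
    using assms unfolding agreed_def by (auto simp: set_tau)
  have pR: "p l \<in> R \<theta> l" for l using p by (simp add: profiles_def)
  show ?thesis
  proof (cases x)
    case None
    with q pR show ?thesis by (simp add: component_def)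
  next
    case (Some l)
    then obtain r q' where r: "r \<in> set_pmf (perturb i opt l (p l))"
      and q': "q' \<in> set_pmf (bel \<theta> l (p l))" "q = q'(l := r)"
      using q by (auto simp: component_def)
    show ?thesis
    proof (cases "j = l")
      case True
      then show ?thesis using set_perturb[OF r] pR[of l] q' by auto
    next
      case False
      then show ?thesis using bel_rat[OF pR q'(1)] q' by auto
    qed
  qed
qed

lemma set_agreed_subset: "set_pmf (agreed \<theta> i opt) \<subseteq> profiles M"
proof (clarsimp simp: profiles_def)
  fix q j assume "q \<in> set_pmf (agreed \<theta> i opt)"
  from set_agreed[OF this, of j] show "q j \<in> M j"
    using rat_set_subset[of u M g \<theta> j] clamp_in by auto
qed

section \<open>The outcome function\<close>

definition outcome :: "('i \<Rightarrow> ('th, 'i \<Rightarrow> nat) msg) \<Rightarrow> ('i \<Rightarrow> nat) pmf" where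
  "outcome s = (if \<exists>i \<theta>. agree_but i \<theta> s
     then (case SOME (i, \<theta>). agree_but i \<theta> s of (i, \<theta>) \<Rightarrow> agreed \<theta> i (map_of (whistle_list (s i)) \<theta>))
     else if \<exists>i. top_rank i s then return_pmf (clamp_profile (wish (s (THE i. top_rank i s))))
     else return_pmf d)"

text \<open>With three agents, some agent differs from \<open>i\<close> and \<open>j\<close>, and
  his one message announces both states.\<close>

lemma agree_but_unique:
  assumes "agree_but (i :: 'i) \<theta> s" "agree_but j \<eta> s"
  shows "\<eta> = \<theta>"
proof -
  obtain k where "k \<noteq> i" "k \<noteq> j" using third_agent[OF card3] by metis
  then have "s k = Agree \<theta>" "s k = Agree \<eta>" using assms by (auto simp: agree_but_def)
  then show ?thesis by simp
qed

text \<open>The \<open>SOME\<close> in \<open>outcome\<close> is harmless: all candidates share the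
  state, and if two agents qualify as dissenter, both announce \<theta> and request nothing.\<close>

lemma outcome_agree:
  assumes "agree_but i \<theta> s"
  shows "outcome s = agreed \<theta> i (map_of (whistle_list (s i)) \<theta>)"
proof -
  obtain j \<eta> where j: "(SOME (i, \<theta>). agree_but i \<theta> s) = (j, \<eta>)"
    by (metis surj_pair)
  have "case (j, \<eta>) of (i, \<theta>) \<Rightarrow> agree_but i \<theta> s"
    unfolding j[symmetric] by (rule someI[of _ "(i, \<theta>)"]) (simp add: assms)
  then have s: "agree_but j \<eta> s" by simp
  have \<eta>: "\<eta> = \<theta>" using agree_but_unique[OF assms s] .
  have "agreed \<eta> j (map_of (whistle_list (s j)) \<eta>) = agreed \<theta> i (map_of (whistle_list (s i)) \<theta>)"
  proof (cases "i = j")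
    case False
    then have "s i = Agree \<theta>" "s j = Agree \<theta>" using assms s \<eta> by (auto simp: agree_but_def)
    then show ?thesis using \<eta> agreed_None by simp
  qed (simp add: \<eta>)
  then show ?thesis using assms j by (auto simp: outcome_def)
qed

lemma outcome_top:
  assumes "\<nexists>i \<theta>. agree_but i \<theta> s" "top_rank i s"
  shows "outcome s = return_pmf (clamp_profile (wish (s i)))"
proof -
  have ex: "\<exists>i. top_rank i s" using assms(2) by blast
  have the: "(THE i. top_rank i s) = i"
    using assms(2) by (rule the_equality) (rule top_rank_unique[OF _ assms(2)])
  show ?thesis unfolding outcome_def if_not_P[OF assms(1)] if_P[OF ex] the ..
qed

lemma set_outcome: "set_pmf (outcome s) \<subseteq> profiles M"
  using set_agreed_subset d clamp_profile_in
  by (auto simp: outcome_def split: prod.splits)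

section \<open>Coding by naturals, and payoffs against mixed strategies\<close>

definition decode :: "('i \<Rightarrow> nat) \<Rightarrow> ('i \<Rightarrow> ('th, 'i \<Rightarrow> nat) msg)" where
  "decode f = (\<lambda>j. from_nat (f j))"

lemma decode_upd: "decode (f(i := to_nat t)) = (decode f)(i := t)"
  by (auto simp: decode_def)

text \<open>\<open>from_nat\<close> is total, so every natural codes a message and
  \<open>UNIV\<close> can serve as every message space.\<close>

definition G :: "('i \<Rightarrow> nat) \<Rightarrow> 'z pmf" where
  "G f = bind_pmf (outcome (decode f)) g"

abbreviation others :: "('i \<Rightarrow> nat pmf) \<Rightarrow> 'i \<Rightarrow> ('i \<Rightarrow> nat) pmf" where
  "others lam i \<equiv> Pi_pmf (UNIV - {i}) 0 lam"

definition payoff :: "'th \<Rightarrow> ('i \<Rightarrow> nat pmf) \<Rightarrow> 'i \<Rightarrow> nat \<Rightarrow> real" where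
  "payoff \<theta> lam i t = measure_pmf.expectation (others lam i) (\<lambda>f. EV \<theta> i (outcome (decode (f(i := t)))))"

lemma payoff_bound: "\<bar>payoff \<theta> lam i t\<bar> \<le> util_bound u i \<theta>"
  unfolding payoff_def by (rule abs_expectation_le[OF EV_bound])

lemma EU_G: "EU u i \<theta> (G f) = EV \<theta> i (outcome (decode f))"
  unfolding G_def EU_bind EV_def V_def ..

lemma EU_deviation:
  "EU u i \<theta> (induced_lottery G (lam(i := \<mu>))) = measure_pmf.expectation \<mu> (payoff \<theta> lam i)"
proof -
  have "EU u i \<theta> (induced_lottery G (lam(i := \<mu>)))
    = EV \<theta> i (bind_pmf \<mu> (\<lambda>t. bind_pmf (others lam i) (\<lambda>f. outcome (decode (f(i := t))))))"
    unfolding induced_lottery_def EU_bind Pi_pmf_fun_upd EU_G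
    by (simp add: EV_bind[symmetric] bind_assoc_pmf map_pmf_def bind_return_pmf)
  then show ?thesis by (simp add: EV_bind payoff_def[abs_def])
qed

text \<open>Pure deviations show that no message earns more than the equilibrium value, which is the
  average over \<open>lam i\<close>; so messages in the support earn exactly this value.\<close>

lemma MNE_payoff:
  assumes "lam \<in> MNE u (\<lambda>_. UNIV) G \<theta>" "t \<in> set_pmf (lam i)"
  shows "payoff \<theta> lam i t' \<le> payoff \<theta> lam i t"
proof -
  let ?v = "EU u i \<theta> (induced_lottery G lam)"
  have le: "payoff \<theta> lam i t' \<le> ?v" for t'
  proof -
    have "EU u i \<theta> (induced_lottery G (lam(i := return_pmf t'))) \<le> ?v"
      using assms(1) by (simp add: MNE_def)
    then show ?thesis by (simp add: EU_deviation)
  qed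
  have "?v = measure_pmf.expectation (lam i) (payoff \<theta> lam i)"
    using EU_deviation[of i \<theta> lam "lam i"] by simp
  then have "payoff \<theta> lam i t = ?v"
    using le by (intro expectation_eqD[OF payoff_bound, of "\<lambda>_. ?v" "\<bar>?v\<bar>" "lam i"]) (auto simp: assms(2))
  with le show ?thesis by simp
qed

section \<open>Suprema of payoffs and limits of deviations\<close>

definition best :: "'th \<Rightarrow> 'i \<Rightarrow> real" where
  "best \<theta> i = (SUP a\<in>profiles M. V \<theta> i a)"

lemma bdd_above_V: "bdd_above (V \<theta> i ` profiles M)"
  using V_bound[of \<theta> i] by (intro bdd_aboveI2[where M = "util_bound u i \<theta>"]) (simp add: abs_le_iff)

lemma V_le_best: "a \<in> profiles M \<Longrightarrow> V \<theta> i a \<le> best \<theta> i"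
  unfolding best_def by (rule cSUP_upper[OF _ bdd_above_V])

lemma best_bound: "\<bar>best \<theta> i\<bar> \<le> util_bound u i \<theta>"
proof -
  have "best \<theta> i \<le> util_bound u i \<theta>"
    unfolding best_def using V_bound[of \<theta> i] d by (intro cSUP_least) (auto simp: abs_le_iff)
  moreover have "- util_bound u i \<theta> \<le> best \<theta> i"
    using V_le_best[OF d, of \<theta> i] V_bound[of \<theta> i d] by linarith
  ultimately show ?thesis by linarith
qed

lemma EV_le_best:
  assumes "set_pmf p \<subseteq> profiles M"
  shows "EV \<theta> i p \<le> best \<theta> i"
proof -
  have "EV \<theta> i p \<le> measure_pmf.expectation p (\<lambda>_. best \<theta> i)"
    unfolding EV_def using assms V_le_best by (intro expectation_mono_pmf[OF V_bound best_bound]) auto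
  then show ?thesis by simp
qed

lemma EV_eq_bestD:
  assumes "set_pmf p \<subseteq> profiles M" "EV \<theta> i p = best \<theta> i" "m \<in> set_pmf p"
  shows "V \<theta> i m = best \<theta> i"
proof (rule expectation_eqD[where f = "V \<theta> i" and h = "\<lambda>_. best \<theta> i", OF V_bound best_bound])
  show "measure_pmf.expectation p (\<lambda>_. best \<theta> i) \<le> measure_pmf.expectation p (V \<theta> i)"
    using assms(2) by (simp add: EV_def)
qed (use assms V_le_best in auto)

text \<open>What agent \<open>i\<close> gets in the limit from the whistle list \<open>W\<close> and ever larger integers.\<close>
definition limit_payoff :: "'th \<Rightarrow> 'i \<Rightarrow> ('th \<times> nat \<times> nat \<times> nat) list \<Rightarrow> real
    \<Rightarrow> ('i \<Rightarrow> ('th, 'i \<Rightarrow> nat) msg) \<Rightarrow> real" where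
  "limit_payoff \<theta>' i W w s = (if \<exists>\<theta>. agree_but i \<theta> s
     then EV \<theta>' i (agreed (THE \<theta>. agree_but i \<theta> s) i (map_of W (THE \<theta>. agree_but i \<theta> s))) else w)"

lemma limit_payoff_agree:
  assumes "agree_but i \<theta> s"
  shows "limit_payoff \<theta>' i W w s = EV \<theta>' i (agreed \<theta> i (map_of W \<theta>))"
proof -
  have ex: "\<exists>\<theta>. agree_but i \<theta> s" using assms by blast
  have the: "(THE \<theta>. agree_but i \<theta> s) = \<theta>"
    using assms by (rule the_equality) (rule agree_but_unique[OF assms])
  show ?thesis unfolding limit_payoff_def if_P[OF ex] the ..
qed

lemma limit_payoff_no_agree: "\<nexists>\<theta>. agree_but i \<theta> s \<Longrightarrow> limit_payoff \<theta>' i W w s = w"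
  by (simp add: limit_payoff_def)

lemma limit_payoff_bound:
  "\<bar>w\<bar> \<le> util_bound u i \<theta> \<Longrightarrow> \<bar>limit_payoff \<theta> i W w s\<bar> \<le> util_bound u i \<theta>"
  unfolding limit_payoff_def using EV_bound by auto

text \<open>Against agreement the bid \<open>n\<close> has no effect; otherwise large bids win the
  integer game.\<close>

lemma Dev_tendsto:
  "(\<lambda>n. EV \<theta> i (outcome (s(i := Dev n W a)))) \<longlonglongrightarrow> limit_payoff \<theta> i W (V \<theta> i (clamp_profile a)) s"
proof (cases "\<exists>\<eta>. agree_but i \<eta> s")
  case True
  then obtain \<eta> where \<eta>: "agree_but i \<eta> s" by blast
  then have "outcome (s(i := Dev n W a)) = agreed \<eta> i (map_of W \<eta>)" for n
    by (subst outcome_agree[of i \<eta>]) auto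
  then show ?thesis using limit_payoff_agree[OF \<eta>] by simp
next
  case False
  have "outcome (s(i := Dev n W a)) = return_pmf (clamp_profile a)" if n: "n > (\<Sum>j\<in>UNIV. rank (s j))" for n
  proof -
    have "rank (s j) \<le> (\<Sum>j\<in>UNIV. rank (s j))" for j by (rule member_le_sum) auto
    then have "top_rank i (s(i := Dev n W a))"
      using n by (auto simp: top_rank_def intro: le_less_trans)
    \<comment> \<open>A dissenter other than \<open>i\<close> would need \<open>Agree\<close> from
      \<open>i\<close>, who sends \<open>Dev\<close>; \<open>i\<close> himself is excluded by
      \<open>False\<close>.\<close>
    moreover have "\<nexists>j \<eta>. agree_but j \<eta> (s(i := Dev n W a))"
    proof safe
      fix j \<eta> assume *: "agree_but j \<eta> (s(i := Dev n W a))"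
      then show False using False by (cases "j = i") (auto simp: agree_but_def split: if_splits)
    qed
    ultimately show ?thesis by (subst outcome_top) auto
  qed
  then have "eventually (\<lambda>n. EV \<theta> i (outcome (s(i := Dev n W a))) = V \<theta> i (clamp_profile a)) sequentially"
    by (intro eventually_mono[OF eventually_gt_at_top[of "\<Sum>j\<in>UNIV. rank (s j)"]]) auto
  then show ?thesis using limit_payoff_no_agree[OF False]
    by (auto intro: tendsto_eventually)
qed

text \<open>No bid \<open>n\<close> is a profitable deviation, hence neither is their limit, which
  dominated convergence moves inside the expectation.\<close>

lemma MNE_limit_payoff:
  assumes "lam \<in> MNE u (\<lambda>_. UNIV) G \<theta>" "t \<in> set_pmf (lam i)"
  shows "measure_pmf.expectation (others lam i) (\<lambda>f. limit_payoff \<theta> i W (best \<theta> i) (decode f))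
    \<le> payoff \<theta> lam i t"
proof (rule field_le_epsilon)
  fix e :: real assume e: "e > 0"
  \<comment> \<open>The supremum need not be attained when message spaces are infinite, so the wish
    only comes within \<open>e\<close> of it.\<close>
  obtain a where a: "a \<in> profiles M" "best \<theta> i - e < V \<theta> i a"
    using less_cSUP_iff[of "profiles M" "V \<theta> i" "best \<theta> i - e"] d bdd_above_V e
    unfolding best_def by auto
  let ?B = "others lam i" and ?K = "util_bound u i \<theta>"
  have "(\<lambda>n. payoff \<theta> lam i (to_nat (Dev n W a)))
    \<longlonglongrightarrow> measure_pmf.expectation ?B (\<lambda>f. limit_payoff \<theta> i W (V \<theta> i a) (decode f))"
    unfolding payoff_def decode_upd
    using Dev_tendsto[of \<theta> i _ W a] EV_bound[of \<theta> i]
    by (intro integral_dominated_convergence[where w = "\<lambda>_. ?K"])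
       (auto simp: clamp_profile_id[OF a(1)])
  then have lim: "measure_pmf.expectation ?B (\<lambda>f. limit_payoff \<theta> i W (V \<theta> i a) (decode f)) \<le> payoff \<theta> lam i t"
    by (rule LIMSEQ_le_const2) (use MNE_payoff[OF assms] in auto)
  have "measure_pmf.expectation ?B (\<lambda>f. limit_payoff \<theta> i W (best \<theta> i) (decode f))
      \<le> measure_pmf.expectation ?B (\<lambda>f. limit_payoff \<theta> i W (V \<theta> i a) (decode f) + e)"
  proof (rule integral_mono)
    show "integrable ?B (\<lambda>f. limit_payoff \<theta> i W (best \<theta> i) (decode f))"
      by (rule integrable_pmf_bounded[OF limit_payoff_bound[OF best_bound]])
    show "integrable ?B (\<lambda>f. limit_payoff \<theta> i W (V \<theta> i a) (decode f) + e)"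
      by (intro Bochner_Integration.integrable_add integrable_pmf_bounded[OF limit_payoff_bound[OF V_bound]]) simp
  qed (use a e in \<open>auto simp: limit_payoff_def\<close>)
  also have "\<dots> = measure_pmf.expectation ?B (\<lambda>f. limit_payoff \<theta> i W (V \<theta> i a) (decode f)) + e"
    by (subst Bochner_Integration.integral_add)
       (auto intro!: integrable_pmf_bounded limit_payoff_bound V_bound)
  finally show "measure_pmf.expectation ?B (\<lambda>f. limit_payoff \<theta> i W (best \<theta> i) (decode f))
    \<le> payoff \<theta> lam i t + e" using lim by linarith
qed

section \<open>What equilibrium says at each profile played\<close>

lemma MNE_pointwise:
  assumes mne: "lam \<in> MNE u (\<lambda>_. UNIV) G \<theta>'" and s: "\<And>j. s j \<in> set_pmf (lam j)"
    and W: "\<And>\<theta>. EV \<theta>' i (agreed \<theta> i (map_of (whistle_list (decode s i)) \<theta>)) \<le> EV \<theta>' i (agreed \<theta> i (map_of W \<theta>))"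
  shows "EV \<theta>' i (outcome (decode s)) = limit_payoff \<theta>' i W (best \<theta>' i) (decode s)"
proof -
  let ?f = "s(i := 0)"
  have f: "?f \<in> set_pmf (others lam i)"
    using s by (auto simp: set_Pi_pmf PiE_dflt_def)
  have upd: "decode (f(i := s i)) = (decode f)(i := decode s i)" for f
    by (auto simp: decode_def)
  have lp: "limit_payoff \<theta>' i W w (t(i := x)) = limit_payoff \<theta>' i W w t" for w t x
    by (simp add: limit_payoff_def)
  have "EV \<theta>' i (outcome (decode (?f(i := s i)))) = limit_payoff \<theta>' i W (best \<theta>' i) (decode ?f)"
  \<comment> \<open>For each \<open>f\<close> the inequality holds: under agreement \<open>W\<close>
    is as good as the list sent, and elsewhere nothing beats \<open>best\<close>. Equilibrium
    reverses it on average, so both sides coincide on the support.\<close>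
  proof (rule expectation_eqD[OF EV_bound limit_payoff_bound[OF best_bound] _ _ f])
    fix f
    show "EV \<theta>' i (outcome (decode (f(i := s i)))) \<le> limit_payoff \<theta>' i W (best \<theta>' i) (decode f)"
    proof (cases "\<exists>\<theta>. agree_but i \<theta> (decode f)")
      case True
      then obtain \<theta> where \<theta>: "agree_but i \<theta> (decode f)" by blast
      then have "outcome (decode (f(i := s i))) = agreed \<theta> i (map_of (whistle_list (decode s i)) \<theta>)"
        unfolding upd by (subst outcome_agree[of i \<theta>]) auto
      then show ?thesis using W limit_payoff_agree[OF \<theta>] by simp
    next
      case False
      then show ?thesis using limit_payoff_no_agree[OF False] EV_le_best[OF set_outcome] by simp
    qed
  next
    show "measure_pmf.expectation (others lam i) (\<lambda>f. limit_payoff \<theta>' i W (best \<theta>' i) (decode f))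
      \<le> measure_pmf.expectation (others lam i) (\<lambda>f. EV \<theta>' i (outcome (decode (f(i := s i)))))"
      using MNE_limit_payoff[OF mne s] unfolding payoff_def .
  qed
  moreover have "decode s = (decode ?f)(i := decode s i)" by (auto simp: decode_def)
  then have "limit_payoff \<theta>' i W (best \<theta>' i) (decode ?f) = limit_payoff \<theta>' i W (best \<theta>' i) (decode s)"
    using lp by metis
  ultimately show ?thesis by simp
qed

text \<open>Without agreement among the others the integer game is within reach of \<open>i\<close>,
  so the lottery must already be worth \<open>best\<close> to him.\<close>

lemma MNE_best:
  assumes "lam \<in> MNE u (\<lambda>_. UNIV) G \<theta>'" "\<And>j. s j \<in> set_pmf (lam j)"
    and "\<nexists>\<theta>. agree_but i \<theta> (decode s)" "m \<in> set_pmf (outcome (decode s))"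
  shows "V \<theta>' i m = best \<theta>' i"
  using MNE_pointwise[OF assms(1,2), of i "whistle_list (decode s i)"] limit_payoff_no_agree[OF assms(3)]
    EV_eq_bestD[OF set_outcome _ assms(4)] by simp

lemma MNE_option:
  assumes "lam \<in> MNE u (\<lambda>_. UNIV) G \<theta>'" "\<And>j. s j \<in> set_pmf (lam j)"
    and agree: "agree_but i \<theta> (decode s)"
  shows "EV \<theta>' i (agreed \<theta> i (Some opt)) \<le> EV \<theta>' i (agreed \<theta> i (map_of (whistle_list (decode s i)) \<theta>))"
proof (rule ccontr)
  assume *: "\<not> ?thesis"
  \<comment> \<open>The new entry overrides the request at \<theta> and leaves all other states
    alone, so \<open>?W\<close> is nowhere worse.\<close>
  let ?W = "(\<theta>, opt) # whistle_list (decode s i)"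
  have "EV \<theta>' i (outcome (decode s)) = limit_payoff \<theta>' i ?W (best \<theta>' i) (decode s)"
    using * by (intro MNE_pointwise[OF assms(1,2)]) auto
  with * show False using outcome_agree[OF agree] limit_payoff_agree[OF agree] by simp
qed

text \<open>The factor \<open>tilt k\<close> is never maximal, so that in equilibrium no whistle pays strictly.\<close>
lemma MNE_gain:
  assumes mne: "lam \<in> MNE u (\<lambda>_. UNIV) G \<theta>'" "\<And>j. s j \<in> set_pmf (lam j)"
    and agree: "agree_but i \<theta> (decode s)"
  shows "m \<in> R \<theta> i \<Longrightarrow> m' \<in> M i \<Longrightarrow> gain \<theta>' \<theta> i m m' \<le> 0"
    and "map_of (whistle_list (decode s i)) \<theta> = Some (m, m', k) \<Longrightarrow> k > 0 \<Longrightarrow> m \<in> R \<theta> i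
      \<Longrightarrow> gain \<theta>' \<theta> i m (clamp i m') \<ge> 0"
proof -
  let ?o = "map_of (whistle_list (decode s i)) \<theta>"
  note opt = MNE_option[OF mne agree]
  have nonneg: "gain \<theta>' \<theta> i m (clamp i m') \<ge> 0"
    if "?o = Some (m, m', k)" "k > 0" "m \<in> R \<theta> i" for m m' k
  proof -
    \<comment> \<open>Comparison with \<open>k = 0\<close>, that is, with no replacement.\<close>
    have "0 \<le> weight \<theta> i m * tilt k * gain \<theta>' \<theta> i m (clamp i m')"
      using opt[of "(m, m', 0)"] unfolding that(1) EV_agreed_Some by simp
    moreover have "weight \<theta> i m * tilt k > 0" using weight_pos[OF that(3)] tilt_pos[OF that(2)] by simp
    ultimately show ?thesis by (simp add: zero_le_mult_iff)
  qed
  have nonpos: "gain \<theta>' \<theta> i m (clamp i m') \<le> 0"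
    if "?o = Some (m, m', k)" "m \<in> R \<theta> i" for m m' k
  proof -
    \<comment> \<open>Raising \<open>k\<close> by one cannot help, so the gain is not
      positive.\<close>
    have "weight \<theta> i m * tilt (Suc k) * gain \<theta>' \<theta> i m (clamp i m')
      \<le> weight \<theta> i m * tilt k * gain \<theta>' \<theta> i m (clamp i m')"
      using opt[of "(m, m', Suc k)"] unfolding that(1) EV_agreed_Some by simp
    then have "weight \<theta> i m * (tilt (Suc k) - tilt k) * gain \<theta>' \<theta> i m (clamp i m') \<le> 0"
      by (simp add: algebra_simps)
    moreover have "tilt (Suc k) - tilt k > 0"
      using tilt_less_Suc[of k] by simp
    then have "weight \<theta> i m * (tilt (Suc k) - tilt k) > 0"
      using weight_pos[OF that(2)] by (rule mult_pos_pos[rotated])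
    ultimately show ?thesis by (metis mult_pos_pos not_le)
  qed
  show "gain \<theta>' \<theta> i m (clamp i m') \<ge> 0" if "?o = Some (m, m', k)" "k > 0" "m \<in> R \<theta> i"
    using nonneg that .
  \<comment> \<open>The request in force is no better than none: its gain is at most 0, or it
    concerns a message of weight 0.\<close>
  have le: "EV \<theta>' i (agreed \<theta> i ?o) \<le> EV \<theta>' i (agreed \<theta> i None)"
  proof (cases ?o)
    case (Some x)
    obtain n n' k where x: "x = (n, n', k)" by (metis surj_pair)
    show ?thesis
    proof (cases "n \<in> R \<theta> i")
      case True
      then have "weight \<theta> i n * tilt k * gain \<theta>' \<theta> i n (clamp i n') \<le> 0"
        using nonpos[of n n' k] Some x weight_pos[OF True] by (intro mult_nonneg_nonpos) auto
      then show ?thesis unfolding Some x EV_agreed_Some by simp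
    next
      case False
      then have "weight \<theta> i n = 0" by (rule weight_zero)
      then show ?thesis unfolding Some x EV_agreed_Some by simp
    qed
  qed simp
  show "gain \<theta>' \<theta> i m m' \<le> 0" if "m \<in> R \<theta> i" "m' \<in> M i"
  proof -
    \<comment> \<open>A profitable replacement, requested with \<open>k = 1\<close>, would beat no
      request and hence the one in force.\<close>
    have "EV \<theta>' i (agreed \<theta> i (Some (m, m', 1))) \<le> EV \<theta>' i (agreed \<theta> i None)"
      using opt le by (rule order_trans)
    then show ?thesis unfolding EV_agreed_Some
      using weight_pos[OF that(1)] clamp_id[OF that(2)] tilt_pos[of 1] by (simp add: mult_le_0_iff)
  qed
qed

section \<open>Equilibrium outcomes are rationalizable\<close>

lemma gain_best_reply:
  assumes "m \<in> R \<theta> i" "r \<in> M i" "gain \<theta>' \<theta> i m r \<ge> 0"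
    and "\<And>m'. m' \<in> M i \<Longrightarrow> gain \<theta>' \<theta> i m m' \<le> 0"
    and "\<And>j. j \<noteq> i \<Longrightarrow> R \<theta> j \<subseteq> T j"
  shows "r \<in> best_reply u M g \<theta>' T i"
\<comment> \<open>\<open>gain\<close> compares with \<open>m\<close> under this belief. No message
  gains and \<open>r\<close> does not lose, so \<open>r\<close> is optimal.\<close>
proof (rule best_replyI[where b = "bel \<theta> i m"])
  show "r \<in> M i" by fact
  show "q j \<in> M j \<and> q j \<in> T j" if "q \<in> set_pmf (bel \<theta> i m)" "j \<noteq> i" for q j
    using bel_rat[OF assms(1) that] assms(5)[OF that(2)] rat_set_subset[of u M g \<theta> j] by auto
  show "measure_pmf.expectation (bel \<theta> i m) (\<lambda>m. EU u i \<theta>' (g (m(i := mi'))))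
      \<le> measure_pmf.expectation (bel \<theta> i m) (\<lambda>m. EU u i \<theta>' (g (m(i := r))))" if "mi' \<in> M i" for mi'
    using assms(3) assms(4)[OF that] by (simp add: gain_def EV_map V_def)
qed

lemma MNE_outcome_rationalizable:
  assumes mne: "lam \<in> MNE u (\<lambda>_. UNIV) G \<theta>'" and s: "\<And>j. s j \<in> set_pmf (lam j)"
    and m: "m \<in> set_pmf (outcome (decode s))"
  shows "m \<in> profiles (R \<theta>')"
proof (cases "\<exists>i \<theta>. agree_but i \<theta> (decode s)")
  case False
  have mM: "m \<in> profiles M" using m set_outcome by blast
  \<comment> \<open>No agent faces agreement, so all attain \<open>best\<close> at \<open>m\<close>,
    and the singletons support each other as best replies.\<close>
  have "(\<lambda>j. {m j}) \<le> R \<theta>'"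
  proof (rule rat_set_coinduct, intro le_funI subsetI)
    fix j x assume "x \<in> {m j}"
    moreover have "V \<theta>' j m = best \<theta>' j" using MNE_best[OF mne s _ m] False by blast
    then have "m j \<in> best_reply u M g \<theta>' (\<lambda>j. {m j}) j"
      using mM V_le_best[of _ \<theta>' j] by (intro best_replyI_pure) (auto simp: profiles_def V_def)
    ultimately show "x \<in> best_reply u M g \<theta>' (\<lambda>j. {m j}) j" by simp
  qed
  then show ?thesis by (auto simp: profiles_def le_fun_def)
next
  case True
  then obtain i \<theta> where agree: "agree_but i \<theta> (decode s)" by blast
  define opt where "opt = map_of (whistle_list (decode s i)) \<theta>"
  have out: "outcome (decode s) = agreed \<theta> i opt"
    using outcome_agree[OF agree] by (simp add: opt_def)
  \<comment> \<open>\<open>T\<close> adds to \<open>R \<theta>\<close> the message that an active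
    request may bring in; \<open>set_agreed\<close> then puts every outcome into it.\<close>
  define T where "T = (\<lambda>j. R \<theta> j \<union> {r. \<exists>m m' k. opt = Some (m, m', k) \<and> k > 0 \<and> m \<in> R \<theta> i \<and> j = i \<and> r = clamp i m'})"
  have RT: "R \<theta> j \<subseteq> T j" for j by (auto simp: T_def)
  have "T \<le> R \<theta>'"
  proof (rule rat_set_coinduct, intro le_funI subsetI)
    fix j r assume r: "r \<in> T j"
    show "r \<in> best_reply u M g \<theta>' T j"
    proof (cases "r \<in> R \<theta> j")
      case True
      then have rM: "r \<in> M j" by (rule subsetD[OF rat_set_subset])
      show ?thesis
      proof (cases "agree_but j \<theta> (decode s)")
        case a: True
        show ?thesis
          using MNE_gain(1)[OF mne s a True] RT by (intro gain_best_reply[OF True rM]) (auto simp: gain_def)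
      next
        case na: False
        then have "j \<noteq> i" using agree by blast
        have none: "\<nexists>\<eta>. agree_but j \<eta> (decode s)"
        proof safe
          fix \<eta> assume b: "agree_but j \<eta> (decode s)"
          with na agree_but_unique[OF agree b] show False by simp
        qed
        \<comment> \<open>All of \<open>R \<theta>\<close> is in the support of the outcome, so any
          such \<open>p\<close> is maximal for \<open>j\<close>, who faces no agreement; one through
          \<open>r\<close> is needed.\<close>
        obtain p where p: "p \<in> profiles (R \<theta>)" "p j = r"
        proof -
          obtain p where "p \<in> profiles (R \<theta>)"
            using set_pmf_not_empty[of "tau \<theta>"] by (auto simp: set_tau)
          then show ?thesis using True by (intro that[of "p(j := r)"]) (auto simp: profiles_def)
        qed
        then have "p \<in> set_pmf (outcome (decode s))" unfolding out using rat_profiles_subset_agreed by blast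
        then have "V \<theta>' j p = best \<theta>' j" using MNE_best[OF mne s none] by blast
        moreover have "p l \<in> M l" "p l \<in> T l" for l
          using p(1) RT[of l] rat_set_subset[of u M g \<theta> l] by (auto simp: profiles_def)
        ultimately have "p j \<in> best_reply u M g \<theta>' T j"
          using V_le_best[of _ \<theta>' j] by (intro best_replyI_pure) (auto simp: V_def)
        then show ?thesis using p by simp
      qed
    next
      case False
      then obtain n n' k where o: "opt = Some (n, n', k)" "k > 0" "n \<in> R \<theta> i" "j = i" "r = clamp i n'"
        using r by (auto simp: T_def)
      \<comment> \<open>The substitute is a best reply to the belief of the message \<open>n\<close>
        that it replaces, as an active request cannot lose.\<close>
      show ?thesis unfolding o(4,5)
        using MNE_gain[OF mne s agree] o RT
        by (intro gain_best_reply[OF o(3) clamp_in]) (auto simp: opt_def)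
    qed
  qed
  moreover have "m j \<in> T j" for j
    using set_agreed[of m \<theta> i opt j] m unfolding out T_def by blast
  ultimately show ?thesis by (auto simp: profiles_def le_fun_def)
qed

lemma MNE_support:
  assumes "lam \<in> MNE u (\<lambda>_. UNIV) G \<theta>"
  shows "set_pmf (induced_lottery G lam) \<subseteq> (\<Union>m\<in>profiles (R \<theta>). set_pmf (g m))"
proof
  fix z assume "z \<in> set_pmf (induced_lottery G lam)"
  then obtain s m where "s \<in> set_pmf (Pi_pmf UNIV 0 lam)" "m \<in> set_pmf (outcome (decode s))" "z \<in> set_pmf (g m)"
    by (auto simp: induced_lottery_def G_def)
  moreover from this have "s j \<in> set_pmf (lam j)" for j
    by (auto simp: set_Pi_pmf PiE_dflt_def)
  ultimately show "z \<in> (\<Union>m\<in>profiles (R \<theta>). set_pmf (g m))"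
    using MNE_outcome_rationalizable[OF assms, of s m] by blast
qed

section \<open>Truthful announcement as an equilibrium\<close>

definition truth :: "'th \<Rightarrow> 'i \<Rightarrow> nat pmf" where
  "truth \<theta> = (\<lambda>_. return_pmf (to_nat (Agree \<theta> :: ('th, 'i \<Rightarrow> nat) msg)))"

lemma Pi_truth: "Pi_pmf A 0 (truth \<theta>) = return_pmf (\<lambda>j. if j \<in> A then to_nat (Agree \<theta> :: ('th, 'i \<Rightarrow> nat) msg) else 0)"
  unfolding truth_def by (rule Pi_pmf_return_pmf) simp

lemma gain_truth: "m \<in> R \<theta> i \<Longrightarrow> m' \<in> M i \<Longrightarrow> gain \<theta> \<theta> i m m' \<le> 0"
  using bel_opt[of m \<theta> i m'] by (simp add: gain_def EV_map V_def)

text \<open>At the true state \<open>m\<close> is a best reply to its belief, so replacing it cannot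
  gain; messages outside \<open>R \<theta>\<close> have weight 0.\<close>

lemma EV_agreed_truth: "EV \<theta> i (agreed \<theta> i opt) \<le> EV \<theta> i (agreed \<theta> i None)"
proof (cases opt)
  case (Some x)
  obtain m m' k where x: "x = (m, m', k)" by (metis surj_pair)
  have "weight \<theta> i m * tilt k * gain \<theta> \<theta> i m (clamp i m') \<le> 0"
  proof (cases "m \<in> R \<theta> i")
    case True
    then show ?thesis
      using gain_truth clamp_in weight_pos[OF True] by (intro mult_nonneg_nonpos) auto
  next
    case False
    then have "weight \<theta> i m = 0" by (rule weight_zero)
    then show ?thesis by simp
  qed
  then show ?thesis unfolding Some x EV_agreed_Some by simp
qed simp

text \<open>Whatever \<open>i\<close> sends, the others agree on \<theta>, so a deviation amounts at
  most to a request.\<close>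

lemma truth_MNE: "truth \<theta> \<in> MNE u (\<lambda>_. UNIV) G \<theta>"
proof -
  have "EU u i \<theta> (induced_lottery G ((truth \<theta>)(i := \<mu>))) \<le> EU u i \<theta> (induced_lottery G (truth \<theta>))" for i \<mu>
  proof -
    define f where "f = (\<lambda>j. if j \<in> UNIV - {i} then to_nat (Agree \<theta> :: ('th, 'i \<Rightarrow> nat) msg) else 0)"
    have f: "agree_but i \<theta> (decode (f(i := t)))" for t
      by (auto simp: agree_but_def f_def decode_def)
    have pay: "payoff \<theta> (truth \<theta>) i t = EV \<theta> i (outcome (decode (f(i := t))))" for t
      unfolding payoff_def Pi_truth f_def by simp
    have le: "payoff \<theta> (truth \<theta>) i t \<le> EV \<theta> i (agreed \<theta> i None)" for t
      unfolding pay outcome_agree[OF f] by (rule EV_agreed_truth)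
    have "payoff \<theta> (truth \<theta>) i (to_nat (Agree \<theta> :: ('th, 'i \<Rightarrow> nat) msg)) = EV \<theta> i (agreed \<theta> i None)"
      unfolding pay outcome_agree[OF f] by (simp add: decode_def)
    then have "EU u i \<theta> (induced_lottery G (truth \<theta>)) = EV \<theta> i (agreed \<theta> i None)"
      using EU_deviation[of i \<theta> "truth \<theta>" "truth \<theta> i", unfolded fun_upd_triv]
      by (simp add: truth_def)
    moreover have "measure_pmf.expectation \<mu> (payoff \<theta> (truth \<theta>) i)
        \<le> measure_pmf.expectation \<mu> (\<lambda>_. EV \<theta> i (agreed \<theta> i None))"
      using le by (intro expectation_mono_pmf[OF payoff_bound EV_bound])
    ultimately show ?thesis unfolding EU_deviation by simp
  qed
  then show ?thesis by (simp add: MNE_def mixed_profiles_def)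
qed

lemma truth_support: "(\<Union>m\<in>profiles (R \<theta>). set_pmf (g m)) \<subseteq> set_pmf (induced_lottery G (truth \<theta>))"
proof -
  define f where "f = (\<lambda>j::'i. to_nat (Agree \<theta> :: ('th, 'i \<Rightarrow> nat) msg))"
  \<comment> \<open>All agree, so any agent may be named as the dissenter.\<close>
  have "agree_but undefined \<theta> (decode f)" by (simp add: agree_but_def decode_def f_def)
  then have "profiles (R \<theta>) \<subseteq> set_pmf (outcome (decode f))"
    by (simp only: outcome_agree rat_profiles_subset_agreed)
  moreover have "induced_lottery G (truth \<theta>) = G f"
    unfolding induced_lottery_def Pi_truth by (simp add: bind_return_pmf f_def)
  ultimately show ?thesis by (auto simp: G_def)
qed

lemma MNE_implements:
  "(\<Union>lam\<in>MNE u (\<lambda>_. UNIV) G \<theta>. set_pmf (induced_lottery G lam)) = (\<Union>m\<in>profiles (R \<theta>). set_pmf (g m))"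
proof
  show "(\<Union>lam\<in>MNE u (\<lambda>_. UNIV) G \<theta>. set_pmf (induced_lottery G lam)) \<subseteq> (\<Union>m\<in>profiles (R \<theta>). set_pmf (g m))"
    using MNE_support by blast
  show "(\<Union>m\<in>profiles (R \<theta>). set_pmf (g m)) \<subseteq> (\<Union>lam\<in>MNE u (\<lambda>_. UNIV) G \<theta>. set_pmf (induced_lottery G lam))"
    using truth_support truth_MNE by blast
qed

end

section \<open>Choice of default, lotteries and beliefs for a given mechanism\<close>

theorem theorem8:
  fixes u :: "'i::finite \<Rightarrow> 'th::countable \<Rightarrow> 'z::finite \<Rightarrow> real"
    and F :: "'th \<Rightarrow> 'z set"
  assumes "CARD('i) \<ge> 3"
    and "\<And>\<theta>. F \<theta> \<noteq> {}"
    and "rationalizably_implementable u F"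
  shows "mixed_nash_A_implementable u F"
proof -
  obtain M :: "'i \<Rightarrow> nat set" and g where F: "\<And>\<theta>. (\<Union>m\<in>profiles (rat_set u M g \<theta>). set_pmf (g m)) = F \<theta>"
    using assms(3) unfolding rationalizably_implementable_def by blast
  have ne: "profiles (rat_set u M g \<theta>) \<noteq> {}" for \<theta>
    using F[of \<theta>] assms(2)[of \<theta>] by auto
  obtain d where d: "d \<in> profiles M"
    using ne[of undefined] rat_set_subset[of u M g undefined] by (fastforce simp: profiles_def)
  have "\<exists>p. set_pmf p = profiles (rat_set u M g \<theta>)" for \<theta>
    by (rule exists_pmf_with_support[OF countableI_type ne]) blast
  then have "\<exists>tau. \<forall>\<theta>. set_pmf (tau \<theta>) = profiles (rat_set u M g \<theta>)"
    by (intro choice allI)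
  then obtain tau where tau: "\<And>\<theta>. set_pmf (tau \<theta>) = profiles (rat_set u M g \<theta>)"
    by blast
  define rationalizes where "rationalizes \<theta> i m b \<longleftrightarrow>
      (\<forall>q\<in>set_pmf b. \<forall>j. j \<noteq> i \<longrightarrow> q j \<in> rat_set u M g \<theta> j) \<and>
      (\<forall>m'\<in>M i. measure_pmf.expectation b (\<lambda>q. EU u i \<theta> (g (q(i := m'))))
        \<le> measure_pmf.expectation b (\<lambda>q. EU u i \<theta> (g (q(i := m)))))" for \<theta> i m b
  define bel where "bel \<theta> i m = (SOME b. rationalizes \<theta> i m b)" for \<theta> i m
  have bel: "rationalizes \<theta> i m (bel \<theta> i m)" if "m \<in> rat_set u M g \<theta> i" for \<theta> i m
  proof -
    have "m \<in> best_reply u M g \<theta> (rat_set u M g \<theta>) i"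
      using that by (simp only: rat_set_fixpoint)
    then have "\<exists>b. rationalizes \<theta> i m b"
      unfolding best_reply_def rationalizes_def by blast
    then show ?thesis unfolding bel_def by (rule someI_ex)
  qed
  interpret rationalizing_mechanism u M g d tau bel
  proof unfold_locales
    show "CARD('i) \<ge> 3" "d \<in> profiles M" "\<And>\<theta>. set_pmf (tau \<theta>) = profiles (rat_set u M g \<theta>)"
      by (rule assms(1) d tau)+
    show "q j \<in> rat_set u M g \<theta> j"
      if "m \<in> rat_set u M g \<theta> i" "q \<in> set_pmf (bel \<theta> i m)" "j \<noteq> i" for m \<theta> i q j
      using bel[OF that(1)] that(2,3) unfolding rationalizes_def by blast
    show "measure_pmf.expectation (bel \<theta> i m) (\<lambda>q. EU u i \<theta> (g (q(i := m'))))
        \<le> measure_pmf.expectation (bel \<theta> i m) (\<lambda>q. EU u i \<theta> (g (q(i := m))))"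
      if "m \<in> rat_set u M g \<theta> i" "m' \<in> M i" for m \<theta> i m'
      using bel[OF that(1)] that(2) unfolding rationalizes_def by blast
  qed
  show ?thesis
    unfolding mixed_nash_A_implementable_def
    by (intro exI[of _ "\<lambda>_. UNIV"] exI[of _ G] allI) (simp only: MNE_implements F)
qed

end
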